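(* Let $\Phi=\{\phi^t\}_{t\in\mathbb{R}}$ be a continuous flow on a compact metric space $X$. Then for every subset $Y\subseteq X$ (not necessarily compact or invariant) and every $t\ge 0$, $$t\cdot h(\Phi,Y)=h(\phi^t,Y).$$
   Context: A continuous flow on a compact metric space $X$ is a continuous map $\Phi:\mathbb{R}\times X\to X$, $\phi^t(x)=\Phi(t,x)$, with $\phi^0=\mathrm{id}$ and $\phi^{s+t}=\phi^s\circ\phi^t$. Topological entropy of a flow on an arbitrary subset. Let $\mathcal U$ be a finite open cover of $X$. For $B\subseteq X$ write $B\prec\mathcal U$ if $B$ is contained in some element of $\mathcal U$. Let $N(B)=N(\Phi,\mathcal U,B)$ be the largest nonnegative number such that $\phi^t(B)\prec\mathcal U$ for all $0\le t<N(B)$, with $N(B)=0$ if $B\not\prec\mathcal U$ and $N(B)=\infty$ if $\phi^t(B)\prec\mathcal U$ for all $t\ge0$. Put $D(B)=e^{-N(B)}$ if $N(B)<\infty$ and $D(B)=0$ if $N(B)=\infty$. For $\alpha>0$ and a countable collection $\mathcal B=\{B_i\}_{i\ge1}$ of subsets of $X$ put $S_\alpha(\mathcal B)=\sum_{i\ge1}D(B_i)^\alpha$. For $Y\subseteq X$ put $\Gamma_\alpha(Y)=\lim_{\varepsilon\to0}\inf\{S_\alpha(\mathcal E):\mathcal E=\{E_i\}_{i\ge1}\text{ a countable cover of }Y\text{ with }D(E_i)<\varepsilon\text{ for all }i\}$, $h_{\mathcal U}(\Phi,Y)=\inf\{\alpha>0:\Gamma_\alpha(Y)=0\}$ (with $\inf\emptyset=\infty$),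 and $h(\Phi,Y)=\sup\{h_{\mathcal U}(\Phi,Y):\mathcal U\text{ a finite open cover of }X\}$. For a continuous map $f:X\to X$, $h(f,Y)$ (Bowen topological entropy) is defined in the same way, with $N(B)$ replaced by $n(B)$: the largest nonnegative integer such that $f^k(B)\prec\mathcal U$ for all integers $0\le k<n(B)$, with $n(B)=0$ if $B\not\prec\mathcal U$ and $n(B)=\infty$ if $f^k(B)\prec\mathcal U$ for all $k\ge0$. Values lie in $[0,\infty]$, with the convention $0\cdot\infty=0$. *)

theory Defs
  imports "HOL-Analysis.Analysis"
begin

definition continuous_flow :: "(real \<Rightarrow> 'a::metric_space \<Rightarrow> 'a) \<Rightarrow> bool" where
  "continuous_flow \<phi> \<longleftrightarrow>
     continuous_on UNIV (\<lambda>(t, x). \<phi> t x) \<and> \<phi> 0 = id \<and> (\<forall>s t. \<phi> (s + t) = \<phi> s \<circ> \<phi> t)"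

definition finite_open_cover :: "'a::topological_space set set \<Rightarrow> bool" where
  "finite_open_cover \<U> \<longleftrightarrow> finite \<U> \<and> (\<forall>A\<in>\<U>. open A) \<and> \<Union>\<U> = UNIV"

definition subordinate :: "'a set \<Rightarrow> 'a set set \<Rightarrow> bool" where
  "subordinate B \<U> \<longleftrightarrow> (\<exists>A\<in>\<U>. B \<subseteq> A)"

text \<open>The suprema in the next two definitions are attained, so they are the largest such
  numbers; they are \<open>0\<close> if \<open>B\<close> is not subordinate to the cover, and infinite if all forward
  images of \<open>B\<close> are.\<close>

definition flow_time :: "(real \<Rightarrow> 'a \<Rightarrow> 'a) \<Rightarrow> 'a set set \<Rightarrow> 'a set \<Rightarrow> ennreal" where
  "flow_time \<phi> \<U> B = Sup {N. \<forall>t\<ge>0. ennreal t < N \<longrightarrow> subordinate (\<phi> t ` B) \<U>}"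

definition map_time :: "('a \<Rightarrow> 'a) \<Rightarrow> 'a set set \<Rightarrow> 'a set \<Rightarrow> enat" where
  "map_time f \<U> B = Sup {n. \<forall>k. enat k < n \<longrightarrow> subordinate ((f ^^ k) ` B) \<U>}"

definition exp_neg :: "ennreal \<Rightarrow> real" where
  "exp_neg N = (if N = \<infinity> then 0 else exp (- enn2real N))"

text \<open>The remaining construction is common to flows and maps; it depends only on the size
  function \<open>D\<close> (for the last definition, on one size function for each cover). A countable
  collection is a sequence of sets; finite collections are padded with the empty set, whose size
  is \<open>0\<close> for every cover of a (necessarily nonempty) type.\<close>

definition weight_sum :: "('a set \<Rightarrow> real) \<Rightarrow> real \<Rightarrow> (nat \<Rightarrow> 'a set) \<Rightarrow> ennreal" where
  "weight_sum D \<alpha> E = (\<Sum>i. ennreal (D (E i) powr \<alpha>))"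

definition covers_below :: "('a set \<Rightarrow> real) \<Rightarrow> 'a set \<Rightarrow> real \<Rightarrow> (nat \<Rightarrow> 'a set) set" where
  "covers_below D Y \<epsilon> = {E. Y \<subseteq> (\<Union>i. E i) \<and> (\<forall>i. D (E i) < \<epsilon>)}"

definition Gamma_meas :: "('a set \<Rightarrow> real) \<Rightarrow> real \<Rightarrow> 'a set \<Rightarrow> ennreal" where
  "Gamma_meas D \<alpha> Y = Lim (at_right 0) (\<lambda>\<epsilon>. INF E\<in>covers_below D Y \<epsilon>. weight_sum D \<alpha> E)"

definition critical_exponent :: "('a set \<Rightarrow> real) \<Rightarrow> 'a set \<Rightarrow> ennreal" where
  "critical_exponent D Y = Inf (ennreal ` {\<alpha>. \<alpha> > 0 \<and> Gamma_meas D \<alpha> Y = 0})"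

definition cover_entropy ::
    "('a::topological_space set set \<Rightarrow> 'a set \<Rightarrow> real) \<Rightarrow> 'a set \<Rightarrow> ennreal" where
  "cover_entropy D Y = (SUP \<U>\<in>Collect finite_open_cover. critical_exponent (D \<U>) Y)"

definition flow_entropy :: "(real \<Rightarrow> 'a::metric_space \<Rightarrow> 'a) \<Rightarrow> 'a set \<Rightarrow> ennreal" where
  "flow_entropy \<phi> Y = cover_entropy (\<lambda>\<U> B. exp_neg (flow_time \<phi> \<U> B)) Y"

definition map_entropy :: "('a::metric_space \<Rightarrow> 'a) \<Rightarrow> 'a set \<Rightarrow> ennreal" where
  "map_entropy f Y = cover_entropy (\<lambda>\<U> B. exp_neg (ennreal_of_enat (map_time f \<U> B))) Y"

lemma subordinate_before_flow_time:
  assumes "t \<ge> 0" "ennreal t < flow_time \<phi> \<U> B"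
  shows "subordinate (\<phi> t ` B) \<U>"
  using assms unfolding flow_time_def less_Sup_iff by blast

lemma subordinate_before_map_time:
  assumes "enat k < map_time f \<U> B"
  shows "subordinate ((f ^^ k) ` B) \<U>"
  using assms unfolding map_time_def less_Sup_iff by blast

text \<open>The limit defining \<open>Gamma_meas\<close> exists, by monotonicity.\<close>

lemma tendsto_Gamma_meas:
  "((\<lambda>\<epsilon>. INF E\<in>covers_below D Y \<epsilon>. weight_sum D \<alpha> E) \<longlongrightarrow> Gamma_meas D \<alpha> Y) (at_right 0)"
proof -
  let ?g = "\<lambda>\<epsilon>. INF E\<in>covers_below D Y \<epsilon>. weight_sum D \<alpha> E"
  have anti: "?g b \<le> ?g a" if "a \<le> b" for a b
    by (rule INF_superset_mono) (use that in \<open>auto simp: covers_below_def intro: less_le_trans\<close>)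
  have "(?g \<longlongrightarrow> (SUP \<epsilon>\<in>{0<..}. ?g \<epsilon>)) (at_right 0)"
  proof (rule order_tendstoI)
    fix a assume "a < (SUP \<epsilon>\<in>{0<..}. ?g \<epsilon>)"
    then obtain e where e: "e > 0" "a < ?g e"
      unfolding less_SUP_iff by auto
    then show "\<forall>\<^sub>F \<epsilon> in at_right 0. a < ?g \<epsilon>"
      unfolding eventually_at_right_field
      by (intro exI[of _ e]) (auto intro: less_le_trans anti less_imp_le)
  next
    fix a assume a: "(SUP \<epsilon>\<in>{0<..}. ?g \<epsilon>) < a"
    have "?g e < a" if "e > 0" for e
      by (rule le_less_trans[OF SUP_upper a]) (use that in simp)
    then show "\<forall>\<^sub>F \<epsilon> in at_right 0. ?g \<epsilon> < a"
      unfolding eventually_at_right_field by (intro exI[of _ 1]) auto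
  qed
  then show ?thesis
    unfolding Gamma_meas_def by (subst tendsto_Lim) auto
qed

end

theory Submission
  imports Defs
begin

text \<open>For \<open>t > 0\<close> the theorem reduces to comparing, for one set \<open>B\<close>, the time \<open>N(B)\<close> during which
  the flow keeps \<open>B\<close> subordinate to a cover with the number \<open>n(B)\<close> of iterates of \<open>\<phi> t\<close> that do so.

  With the same cover, \<open>N(B) \<le> t \<cdot> n(B)\<close>, because the iterates of \<open>\<phi> t\<close> sample the flow at the
  multiples of \<open>t\<close> (\<open>flow_time_le_map_time\<close>). The reverse inequality may fail for a fixed cover, since
  a set may spread out between two sampling times. But \<open>\<phi>\<close> is uniformly continuous on
  \<open>[0, t] \<times> X\<close>, so every cover \<open>\<U>\<close> has a finer cover \<open>\<V>\<close> such that subordination to \<open>\<V>\<close> at one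
  sampling time forces subordination to \<open>\<U>\<close> until the next one (\<open>exists_controlling_cover\<close>), and
  then \<open>t \<cdot> n\<^sub>\<V>(B) \<le> N\<^sub>\<U>(B)\<close> (\<open>map_time_le_flow_time\<close>). The change of cover is harmless because
  entropy is a supremum over all covers.

  In terms of sizes \<open>D = exp (- N)\<close>, a comparison of times by a factor \<open>c\<close> reads
  \<open>D\<^sub>1 \<le> D\<^sub>2 powr c\<close>. Such an inequality rescales exponents by \<open>c\<close> in every weight sum and hence in
  the critical exponent (\<open>critical_exponent_powr\<close>), just as the Hausdorff dimension scales under
  Hoelder maps. The two comparisons, with factors \<open>1 / t\<close> and \<open>t\<close>, give the two inequalities.

  For \<open>t = 0\<close> the left side vanishes by \<open>0 \<cdot> \<infinity> = 0\<close>, and the identity has entropy \<open>0\<close> because a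
  cover is itself a cover of \<open>Y\<close> by sets of size \<open>0\<close>.\<close>

section \<open>Rescaling of critical exponents\<close>

text \<open>The infimum grows as \<open>\<epsilon>\<close> shrinks, so its limit vanishes only if all its values do.\<close>

lemma Gamma_meas_eq_0_iff:
  "Gamma_meas D \<alpha> Y = 0 \<longleftrightarrow> (\<forall>\<epsilon>>0. (INF E\<in>covers_below D Y \<epsilon>. weight_sum D \<alpha> E) = 0)"
proof -
  let ?g = "\<lambda>\<epsilon>. INF E\<in>covers_below D Y \<epsilon>. weight_sum D \<alpha> E"
  have anti: "?g b \<le> ?g a" if "a \<le> b" for a b
    by (rule INF_superset_mono) (use that in \<open>auto simp: covers_below_def intro: less_le_trans\<close>)
  have lim: "(?g \<longlongrightarrow> Gamma_meas D \<alpha> Y) (at_right 0)"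
    by (rule tendsto_Gamma_meas)
  have "?g \<epsilon> \<le> Gamma_meas D \<alpha> Y" if "\<epsilon> > 0" for \<epsilon>
  proof (rule tendsto_lowerbound[OF lim])
    show "\<forall>\<^sub>F e in at_right 0. ?g \<epsilon> \<le> ?g e"
      unfolding eventually_at_right_field
      by (intro exI[of _ \<epsilon>] conjI allI impI anti that) simp
  qed simp
  moreover have "Gamma_meas D \<alpha> Y = 0" if zero: "\<forall>\<epsilon>>0. ?g \<epsilon> = 0"
  proof (rule tendsto_unique[OF _ lim])
    have "\<forall>\<^sub>F e in at_right 0. ?g e = 0"
      unfolding eventually_at_right_field by (intro exI[of _ 1]) (use zero in simp)
    then show "(?g \<longlongrightarrow> 0) (at_right 0)"
      by (rule tendsto_eventually)
  qed simp
  ultimately show ?thesis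
    by (metis le_zero_eq)
qed

text \<open>A cover that is efficient for \<open>D2\<close> and \<open>\<alpha>\<close> is at least as efficient for \<open>D1\<close> and
  \<open>\<alpha> / c\<close>, because \<open>(D2 powr c) powr (\<alpha> / c) = D2 powr \<alpha>\<close>.\<close>

lemma Gamma_meas_powr:
  assumes D1: "\<And>B. 0 \<le> D1 B" and D2: "\<And>B. 0 \<le> D2 B"
    and le: "\<And>B. D1 B \<le> D2 B powr c"
    and c: "c > 0" and \<alpha>: "\<alpha> > 0"
    and zero: "Gamma_meas D2 \<alpha> Y = 0"
  shows "Gamma_meas D1 (\<alpha> / c) Y = 0"
  unfolding Gamma_meas_eq_0_iff
proof (intro allI impI)
  fix \<epsilon> :: real assume \<epsilon>: "\<epsilon> > 0"
  define \<delta> where "\<delta> = \<epsilon> powr (1 / c)"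
  have \<delta>: "\<delta> > 0" "\<delta> powr c = \<epsilon>"
    using \<epsilon> c by (simp_all add: \<delta>_def powr_powr)
  have "(INF E\<in>covers_below D1 Y \<epsilon>. weight_sum D1 (\<alpha> / c) E)
      \<le> (INF E\<in>covers_below D2 Y \<delta>. weight_sum D2 \<alpha> E)"
  proof (rule INF_mono)
    fix E assume E: "E \<in> covers_below D2 Y \<delta>"
    have "D1 (E i) < \<epsilon>" for i
    proof -
      have "D2 (E i) < \<delta>"
        using E by (simp add: covers_below_def)
      then have "D2 (E i) powr c < \<delta> powr c"
        using D2 c by (intro powr_less_mono2) auto
      then show ?thesis
        using le[of "E i"] \<delta> by simp
    qed
    then have "E \<in> covers_below D1 Y \<epsilon>"
      using E by (simp add: covers_below_def)
    moreover have "weight_sum D1 (\<alpha> / c) E \<le> weight_sum D2 \<alpha> E"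
      unfolding weight_sum_def
    proof (intro suminf_le ennreal_leI)
      fix i
      have "D1 (E i) powr (\<alpha> / c) \<le> (D2 (E i) powr c) powr (\<alpha> / c)"
        using D1 le c \<alpha> by (intro powr_mono2) auto
      also have "\<dots> = D2 (E i) powr \<alpha>"
        using c by (simp add: powr_powr)
      finally show "D1 (E i) powr (\<alpha> / c) \<le> D2 (E i) powr \<alpha>" .
    qed auto
    ultimately show "\<exists>F\<in>covers_below D1 Y \<epsilon>. weight_sum D1 (\<alpha> / c) F \<le> weight_sum D2 \<alpha> E"
      by blast
  qed
  also have "\<dots> = 0"
    using zero \<delta>(1) by (simp add: Gamma_meas_eq_0_iff)
  finally show "(INF E\<in>covers_below D1 Y \<epsilon>. weight_sum D1 (\<alpha> / c) E) = 0"
    by simp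
qed

lemma critical_exponent_powr:
  assumes "\<And>B. 0 \<le> D1 B" and "\<And>B. 0 \<le> D2 B"
    and "\<And>B. D1 B \<le> D2 B powr c" and c: "c > 0"
  shows "ennreal c * critical_exponent D1 Y \<le> critical_exponent D2 Y"
  unfolding critical_exponent_def[of D2]
proof (rule Inf_greatest, elim imageE CollectE conjE)
  fix x \<alpha> assume x: "x = ennreal \<alpha>" and \<alpha>: "\<alpha> > 0" and zero: "Gamma_meas D2 \<alpha> Y = 0"
  have "Gamma_meas D1 (\<alpha> / c) Y = 0"
    by (rule Gamma_meas_powr[OF assms \<alpha> zero])
  then have "critical_exponent D1 Y \<le> ennreal (\<alpha> / c)"
    unfolding critical_exponent_def using \<alpha> c by (intro Inf_lower) auto
  then have "ennreal c * critical_exponent D1 Y \<le> ennreal c * ennreal (\<alpha> / c)"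
    by (rule mult_left_mono) simp
  also have "\<dots> = x"
    using c \<alpha> by (simp add: x flip: ennreal_mult)
  finally show "ennreal c * critical_exponent D1 Y \<le> x" .
qed

lemma exp_neg_nonneg: "0 \<le> exp_neg N"
  by (simp add: exp_neg_def)

lemma exp_neg_le_powr:
  assumes c: "c > 0" and le: "ennreal c * M \<le> N"
  shows "exp_neg N \<le> exp_neg M powr c"
proof (cases "N = \<infinity>")
  case True
  then show ?thesis by (simp add: exp_neg_def)
next
  case False
  then obtain n where n: "N = ennreal n" "n \<ge> 0"
    by (cases N) auto
  have "M \<noteq> \<infinity>"
    using le c n by (auto simp: ennreal_mult_top top_unique)
  then obtain m where m: "M = ennreal m" "m \<ge> 0"
    by (cases M) auto
  have "c * m \<le> n"
    using le c n m by (simp flip: ennreal_mult)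
  then show ?thesis
    using n m by (simp add: exp_neg_def powr_def)
qed

section \<open>Comparison of subordination times\<close>

lemma continuous_flow_funpow:
  assumes "continuous_flow \<phi>"
  shows "(\<phi> t ^^ k) = \<phi> (real k * t)"
proof (induction k)
  case 0
  then show ?case using assms by (simp add: continuous_flow_def id_def)
next
  case (Suc k)
  have "\<phi> (real (Suc k) * t) = \<phi> (t + real k * t)"
    by (simp add: algebra_simps)
  then show ?case using Suc assms by (simp add: continuous_flow_def)
qed

text \<open>If \<open>n\<close> is finite, the \<open>n\<close> good iterates are followed by a bad one, so the flow cannot stay
  subordinate beyond time \<open>n \<cdot> t\<close>.\<close>

lemma flow_time_le_map_time:
  assumes flow: "continuous_flow \<phi>" and t: "t > 0"
  shows "flow_time \<phi> \<U> B \<le> ennreal t * ennreal_of_enat (map_time (\<phi> t) \<U> B)"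
proof (rule ccontr)
  assume "\<not> ?thesis"
  then have less: "ennreal t * ennreal_of_enat (map_time (\<phi> t) \<U> B) < flow_time \<phi> \<U> B"
    by simp
  show False
  proof (cases "map_time (\<phi> t) \<U> B")
    case infinity
    then show ?thesis using less t by (simp add: ennreal_mult_top)
  next
    case (enat n)
    have nt: "ennreal (real n * t) < flow_time \<phi> \<U> B"
      using less enat t by (simp add: ennreal_mult mult.commute ennreal_of_nat_eq_real_of_nat)
    have "subordinate ((\<phi> t ^^ k) ` B) \<U>" if "k \<le> n" for k
    proof -
      have "ennreal (real k * t) < flow_time \<phi> \<U> B"
        using that t by (intro le_less_trans[OF _ nt] ennreal_leI mult_right_mono) auto
      then show ?thesis
        using t by (simp add: continuous_flow_funpow[OF flow] subordinate_before_flow_time)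
    qed
    then have "enat (Suc n) \<le> map_time (\<phi> t) \<U> B"
      unfolding map_time_def by (intro Sup_upper) (simp add: less_Suc_eq_le)
    then show ?thesis using enat by simp
  qed
qed

text \<open>The cover \<open>\<V>\<close> consists of balls so small that the flow up to time \<open>t\<close> moves each of them to
  a set of diameter below a Lebesgue number of \<open>\<U>\<close>.\<close>

lemma exists_controlling_cover:
  fixes \<phi> :: "real \<Rightarrow> 'a::metric_space \<Rightarrow> 'a"
  assumes compact: "compact (UNIV :: 'a set)" and flow: "continuous_flow \<phi>"
    and cover: "finite_open_cover \<U>"
  obtains \<V> where "finite_open_cover \<V>"
    and "\<And>B s. subordinate B \<V> \<Longrightarrow> 0 \<le> s \<Longrightarrow> s \<le> t \<Longrightarrow> subordinate (\<phi> s ` B) \<U>"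
proof -
  obtain \<delta> where \<delta>: "\<delta> > 0" and leb: "\<And>T. diameter T < \<delta> \<Longrightarrow> \<exists>A\<in>\<U>. T \<subseteq> A"
  proof (rule Lebesgue_number_lemma[OF compact])
    show "\<U> \<noteq> {}" "UNIV \<subseteq> \<Union>\<U>" "\<And>A. A \<in> \<U> \<Longrightarrow> open A"
      using cover by (auto simp: finite_open_cover_def)
  qed auto
  have "uniformly_continuous_on ({0..t} \<times> UNIV) (\<lambda>(s, x). \<phi> s x)"
    using flow compact
    by (intro compact_uniformly_continuous compact_Times)
       (auto simp: continuous_flow_def intro: continuous_on_subset)
  then obtain \<gamma> where \<gamma>: "\<gamma> > 0" and small: "\<And>p q. p \<in> {0..t} \<times> UNIV \<Longrightarrow> q \<in> {0..t} \<times> UNIV \<Longrightarrow>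
      dist q p < \<gamma> \<Longrightarrow> dist (case q of (s, x) \<Rightarrow> \<phi> s x) (case p of (s, x) \<Rightarrow> \<phi> s x) < \<delta> / 2"
    using \<delta> unfolding uniformly_continuous_on_def by (meson half_gt_zero)
  obtain C where C: "finite C" "(UNIV :: 'a set) \<subseteq> (\<Union>c\<in>C. ball c (\<gamma> / 2))"
  proof (rule compactE_image[OF compact, of UNIV "\<lambda>c. ball c (\<gamma> / 2)"])
    have "x \<in> ball x (\<gamma> / 2)" for x :: 'a
      using \<gamma> by simp
    then show "(UNIV :: 'a set) \<subseteq> (\<Union>c\<in>UNIV. ball c (\<gamma> / 2))"
      by blast
  qed auto
  show thesis
  proof
    show "finite_open_cover ((\<lambda>c. ball c (\<gamma> / 2)) ` C)"
      using C by (auto simp: finite_open_cover_def)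
  next
    fix B s assume B: "subordinate B ((\<lambda>c. ball c (\<gamma> / 2)) ` C)" and s: "0 \<le> s" "s \<le> t"
    obtain c where c: "B \<subseteq> ball c (\<gamma> / 2)"
      using B by (auto simp: subordinate_def)
    have "dist (\<phi> s x) (\<phi> s y) \<le> \<delta> / 2" if "x \<in> B" "y \<in> B" for x y
    proof -
      have "dist x y < \<gamma>"
        using subsetD[OF c that(1)] subsetD[OF c that(2)]
        by (metis dist_triangle_half_r mem_ball)
      then show ?thesis
        using small[of "(s, y)" "(s, x)"] s by (simp add: dist_Pair_Pair less_imp_le)
    qed
    then have "diameter (\<phi> s ` B) \<le> \<delta> / 2"
      unfolding diameter_def using \<delta>
      by (cases "B = {}") (simp, simp only: image_is_empty if_False, rule cSUP_least, auto)
    then have "diameter (\<phi> s ` B) < \<delta>"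
      using \<delta> by linarith
    then show "subordinate (\<phi> s ` B) \<U>"
      unfolding subordinate_def by (rule leb)
  qed
qed

text \<open>A time \<open>s\<close> before \<open>t \<cdot> n\<close> lies at most \<open>t\<close> after the sampling time \<open>\<lfloor>s / t\<rfloor> \<cdot> t\<close>, whose
  index is below \<open>n\<close>.\<close>

lemma map_time_le_flow_time:
  assumes flow: "continuous_flow \<phi>" and t: "t > 0"
    and control: "\<And>B s. subordinate B \<V> \<Longrightarrow> 0 \<le> s \<Longrightarrow> s \<le> t \<Longrightarrow> subordinate (\<phi> s ` B) \<U>"
  shows "ennreal t * ennreal_of_enat (map_time (\<phi> t) \<V> B) \<le> flow_time \<phi> \<U> B"
  unfolding flow_time_def
proof (intro Sup_upper CollectI allI impI)
  fix s :: real
  assume s: "s \<ge> 0" and less: "ennreal s < ennreal t * ennreal_of_enat (map_time (\<phi> t) \<V> B)"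
  define k where "k = nat \<lfloor>s / t\<rfloor>"
  have "s / t \<ge> 0"
    using s t by simp
  then have k: "real k \<le> s / t" "s / t \<le> real k + 1"
    unfolding k_def by linarith+
  have kt: "real k * t \<le> s" "s - real k * t \<le> t"
    using k t by (simp_all add: field_simps)
  have "enat k < map_time (\<phi> t) \<V> B"
  proof (cases "map_time (\<phi> t) \<V> B")
    case (enat n)
    then have "ennreal s < ennreal (t * real n)"
      using less t by (simp add: ennreal_mult ennreal_of_nat_eq_real_of_nat)
    then have "s < t * real n"
      using s by (simp add: ennreal_less_iff)
    then have "real k * t < real n * t"
      using kt by (simp add: mult.commute)
    then show ?thesis
      using enat t by simp
  qed simp
  then have "subordinate (\<phi> (real k * t) ` B) \<V>"
    using subordinate_before_map_time[of k "\<phi> t" \<V> B] by (simp add: continuous_flow_funpow[OF flow])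
  then have "subordinate (\<phi> (s - real k * t) ` \<phi> (real k * t) ` B) \<U>"
    using kt by (intro control) auto
  moreover have "\<phi> (s - real k * t) \<circ> \<phi> (real k * t) = \<phi> s"
    using flow unfolding continuous_flow_def by (metis diff_add_cancel)
  ultimately show "subordinate (\<phi> s ` B) \<U>"
    by (simp add: image_comp)
qed

section \<open>Entropy of the time-t map\<close>

lemma map_entropy_le_flow_entropy:
  assumes flow: "continuous_flow \<phi>" and t: "t > 0"
  shows "map_entropy (\<phi> t) Y \<le> ennreal t * flow_entropy \<phi> Y"
  unfolding map_entropy_def cover_entropy_def
proof (rule SUP_least)
  fix \<U> :: "'a set set" assume \<U>: "\<U> \<in> Collect finite_open_cover"
  let ?M = "\<lambda>B. exp_neg (ennreal_of_enat (map_time (\<phi> t) \<U> B))"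
  let ?F = "\<lambda>B. exp_neg (flow_time \<phi> \<U> B)"
  have inv: "ennreal (1 / t) * (ennreal t * x) = x" "ennreal t * (ennreal (1 / t) * x) = x" for x
    using t by (simp_all add: mult.assoc[symmetric] flip: ennreal_mult)
  have "ennreal (1 / t) * flow_time \<phi> \<U> B \<le> ennreal_of_enat (map_time (\<phi> t) \<U> B)" for B
    using mult_left_mono[OF flow_time_le_map_time[OF flow t, of \<U> B], of "ennreal (1 / t)"]
    by (simp only: inv zero_le)
  then have "ennreal (1 / t) * critical_exponent ?M Y \<le> critical_exponent ?F Y"
    using t by (intro critical_exponent_powr exp_neg_nonneg exp_neg_le_powr) auto
  also have "\<dots> \<le> flow_entropy \<phi> Y"
    unfolding flow_entropy_def cover_entropy_def by (rule SUP_upper[OF \<U>])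
  finally have "ennreal t * (ennreal (1 / t) * critical_exponent ?M Y)
      \<le> ennreal t * flow_entropy \<phi> Y"
    by (rule mult_left_mono) simp
  then show "critical_exponent ?M Y \<le> ennreal t * flow_entropy \<phi> Y"
    by (simp only: inv)
qed

lemma flow_entropy_le_map_entropy:
  fixes \<phi> :: "real \<Rightarrow> 'a::metric_space \<Rightarrow> 'a"
  assumes compact: "compact (UNIV :: 'a set)" and flow: "continuous_flow \<phi>" and t: "t > 0"
  shows "ennreal t * flow_entropy \<phi> Y \<le> map_entropy (\<phi> t) Y"
  unfolding flow_entropy_def cover_entropy_def SUP_mult_left_ennreal
proof (rule SUP_least, drule CollectD)
  fix \<U> :: "'a set set" assume \<U>: "finite_open_cover \<U>"
  obtain \<V> where \<V>: "finite_open_cover \<V>"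
    and control: "\<And>B s. subordinate B \<V> \<Longrightarrow> 0 \<le> s \<Longrightarrow> s \<le> t \<Longrightarrow> subordinate (\<phi> s ` B) \<U>"
    by (rule exists_controlling_cover[OF compact flow \<U>, of t]) blast
  have "ennreal t * critical_exponent (\<lambda>B. exp_neg (flow_time \<phi> \<U> B)) Y
      \<le> critical_exponent (\<lambda>B. exp_neg (ennreal_of_enat (map_time (\<phi> t) \<V> B))) Y"
    by (intro critical_exponent_powr exp_neg_nonneg exp_neg_le_powr t
        map_time_le_flow_time[OF flow t] control)
  also have "\<dots> \<le> map_entropy (\<phi> t) Y"
    unfolding map_entropy_def cover_entropy_def using \<V> by (intro SUP_upper) simp
  finally show "ennreal t * critical_exponent (\<lambda>B. exp_neg (flow_time \<phi> \<U> B)) Y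
      \<le> map_entropy (\<phi> t) Y" .
qed

text \<open>Iterating the identity never breaks subordination, so the members of a cover have size \<open>0\<close>.\<close>

lemma map_entropy_id: "map_entropy (id :: 'a::metric_space \<Rightarrow> 'a) Y = 0"
proof -
  have "critical_exponent (\<lambda>B. exp_neg (ennreal_of_enat (map_time id \<U> B))) Y = 0"
    (is "critical_exponent ?D Y = 0")
    if \<U>: "finite_open_cover \<U>" for \<U> :: "'a set set"
  proof -
    have ne: "\<U> \<noteq> {}" and union: "\<Union>\<U> = UNIV" and count: "countable \<U>"
      using \<U> by (auto simp: finite_open_cover_def countable_finite)
    have D0: "?D B = 0" if "subordinate B \<U>" for B
    proof -
      have "(\<infinity> :: enat) \<le> map_time id \<U> B"
        unfolding map_time_def using that by (intro Sup_upper) simp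
      then show ?thesis by (simp add: exp_neg_def)
    qed
    define E where "E = from_nat_into \<U>"
    have E0: "?D (E i) = 0" for i
      using from_nat_into[OF ne] by (intro D0) (auto simp: E_def subordinate_def)
    have "(\<Union>i. E i) = UNIV"
      using union range_from_nat_into[OF ne count] by (simp add: E_def)
    then have E: "E \<in> covers_below ?D Y \<epsilon>" if "\<epsilon> > 0" for \<epsilon>
      using that E0 by (simp add: covers_below_def)
    have weight: "weight_sum ?D \<alpha> E = 0" for \<alpha>
      by (simp add: weight_sum_def E0)
    have "(INF F\<in>covers_below ?D Y \<epsilon>. weight_sum ?D \<alpha> F) = 0" if "\<epsilon> > 0" for \<alpha> \<epsilon>
      using INF_lower[OF E[OF that], of "weight_sum ?D \<alpha>"] by (simp only: weight le_zero_eq)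
    then have "Gamma_meas ?D \<alpha> Y = 0" for \<alpha>
      by (simp add: Gamma_meas_eq_0_iff)
    then have "critical_exponent ?D Y \<le> ennreal \<alpha>" if "\<alpha> > 0" for \<alpha>
      unfolding critical_exponent_def using that by (intro Inf_lower) auto
    then have "critical_exponent ?D Y \<le> 0 + ennreal \<alpha>" if "\<alpha> > 0" for \<alpha>
      using that by simp
    then have "critical_exponent ?D Y \<le> 0"
      by (rule ennreal_le_epsilon)
    then show ?thesis by simp
  qed
  then show ?thesis
    unfolding map_entropy_def cover_entropy_def by (intro antisym SUP_least) auto
qed

theorem theorem1:
  fixes \<phi> :: "real \<Rightarrow> 'a::metric_space \<Rightarrow> 'a" and Y :: "'a set" and t :: real
  assumes "compact (UNIV :: 'a set)"
    and "continuous_flow \<phi>"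
    and "t \<ge> 0"
  shows "ennreal t * flow_entropy \<phi> Y = map_entropy (\<phi> t) Y"
proof (cases "t = 0")
  case True
  have "\<phi> 0 = id"
    using assms(2) by (simp add: continuous_flow_def)
  then show ?thesis
    using True by (simp add: map_entropy_id)
next
  case False
  then have "t > 0"
    using assms(3) by simp
  then show ?thesis
    using assms(1,2) by (intro antisym flow_entropy_le_map_entropy map_entropy_le_flow_entropy)
qed

end
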